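(* For every $y>1$ there is a $c=O(y\log nxy)$ (in particular, $c=O(\log n)$ for any fixed $x$ and $y$) such that for all $n$-vertex $m$-edge graphs $G$ of edge-connectivity greater than $c$, $$T(G;x,y)=\frac{y^m}{(y-1)^{n-1}}\,\bigl(1+O(1/n)\bigr).$$
   Context: $T(G;x,y)$ is the Tutte polynomial, in the two variables $x,y$, of the undirected (multi)graph $G=(V,E)$: for connected $G$, $T(G;x,y)=\sum_{A\subseteq E}(x-1)^{\kappa(A)-1}(y-1)^{|A|+\kappa(A)-n}$, where $\kappa(A)$ is the number of connected components of $(V,A)$ and $0^0=1$. The edge-connectivity of $G$ is the minimum number of edges crossing a partition of $V$ into two nonempty groups. In the bound on $c$, $\log nxy$ denotes the logarithm of the product $n\cdot x\cdot y$. *)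

theory Defs
  imports Complex_Main "HOL-Library.Extended_Nat" "HOL-Library.Landau_Symbols"
begin

text \<open>Undirected multigraphs: an edge is mapped to the set of its end vertices, so parallel edges
  are distinct edges with the same value of \<open>ends\<close>, and a loop has a single end vertex.\<close>

record ('v, 'e) multigraph =
  verts :: "'v set"
  edges :: "'e set"
  ends :: "'e \<Rightarrow> 'v set"

definition finite_multigraph :: "('v, 'e) multigraph \<Rightarrow> bool" where
  "finite_multigraph G \<longleftrightarrow>
     finite (verts G) \<and> verts G \<noteq> {} \<and> finite (edges G) \<and>
     (\<forall>e\<in>edges G. ends G e \<subseteq> verts G \<and> (card (ends G e) = 1 \<or> card (ends G e) = 2))"

definition adjacency :: "('v, 'e) multigraph \<Rightarrow> 'e set \<Rightarrow> ('v \<times> 'v) set" where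
  "adjacency G A = {(u, v). u \<in> verts G \<and> v \<in> verts G \<and> (\<exists>e\<in>A. ends G e = {u, v})}"

definition num_components :: "('v, 'e) multigraph \<Rightarrow> 'e set \<Rightarrow> nat" where
  "num_components G A = card (verts G // (adjacency G A)\<^sup>*)"

text \<open>The rank expansion of the Tutte polynomial, in the form valid for connected graphs (for a
  graph with several components, the first exponent would have to be
  \<open>num_components G A - num_components G (edges G)\<close>). Neither subtraction
  on \<open>nat\<close> truncates on a finite multigraph, and \<open>0 ^ 0 = 1\<close>.\<close>

definition tutte :: "('v, 'e) multigraph \<Rightarrow> real \<Rightarrow> real \<Rightarrow> real" where
  "tutte G x y =
     (\<Sum>A\<in>Pow (edges G).
        (x - 1) ^ (num_components G A - 1) *
        (y - 1) ^ (card A + num_components G A - card (verts G)))"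

definition crossing_edges :: "('v, 'e) multigraph \<Rightarrow> 'v set \<Rightarrow> 'e set" where
  "crossing_edges G S =
     {e \<in> edges G. ends G e \<inter> S \<noteq> {} \<and> ends G e \<inter> (verts G - S) \<noteq> {}}"

text \<open>A one-vertex graph has no partition into two nonempty groups; its edge-connectivity is
  \<open>\<infinity>\<close>, the infimum of the empty set.\<close>

definition edge_connectivity :: "('v, 'e) multigraph \<Rightarrow> enat" where
  "edge_connectivity G =
     (INF S\<in>{S. S \<noteq> {} \<and> S \<subset> verts G}. enat (card (crossing_edges G S)))"

end

theory Submission
  imports Defs
begin

text \<open>Put \<open>s = 1 / y\<close> and delete every edge independently with probability \<open>s\<close>. The rank expansion
  says that \<open>T(G;x,y)\<close> is \<open>y^m / (y-1)^(n-1)\<close> times the expectation of \<open>Q^(\<kappa>-1)\<close>, where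
  \<open>Q = (x-1)(y-1)\<close> and \<open>\<kappa>\<close> is the number of components of what remains.

  Let the deletion probability \<open>u\<close> vary. If all cuts have at least \<open>2d\<close> edges and \<open>\<kappa> \<ge> 2\<close>, then at
  least \<open>\<kappa>d\<close> edges join different components. Hence by Russo's formula the expectation of
  \<open>R^\<kappa> - (R-1)\<close> is nondecreasing in \<open>u\<close> along the curve \<open>R = 1 + a u^(-d)\<close>; at \<open>u = 1\<close> it equals
  \<open>(1+a)^n - a\<close>. This bounds the expectation of \<open>R^\<kappa> - R\<close> at \<open>u = s\<close> by about \<open>na\<close> with
  \<open>a = (R-1) s^d\<close>, which is below \<open>1/n\<close> once \<open>d\<close> is of order \<open>ln (nR) / ln y\<close>.\<close>

section \<open>Expectation over a random edge set\<close>

text \<open>\<open>A\<close> is the set of surviving edges. As a finite sum, the expectation is a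
  polynomial in \<open>u\<close> for fixed \<open>f\<close> and can be differentiated
  directly.\<close>

definition deletion_mean :: "'e set \<Rightarrow> real \<Rightarrow> ('e set \<Rightarrow> real) \<Rightarrow> real" where
  "deletion_mean E u f = (\<Sum>A\<in>Pow E. (1 - u) ^ card A * u ^ card (E - A) * f A)"

text \<open>Conditioning on the fate of \<open>e\<close>: deleted with probability \<open>u\<close>,
  kept otherwise. The inductions over the edge set rest on this recursion.\<close>

lemma deletion_mean_insert:
  assumes "finite E" "e \<notin> E"
  shows "deletion_mean (insert e E) u f =
    u * deletion_mean E u f + (1 - u) * deletion_mean E u (\<lambda>A. f (insert e A))"
proof -
  have disj: "Pow E \<inter> insert e ` Pow E = {}"
    using assms by auto
  have inj: "inj_on (insert e) (Pow E)"
    using assms by (intro inj_onI) (auto simp: insert_ident subset_iff)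
  have "deletion_mean (insert e E) u f =
      (\<Sum>A\<in>Pow E. (1 - u) ^ card A * u ^ card (insert e E - A) * f A) +
      (\<Sum>A\<in>insert e ` Pow E. (1 - u) ^ card A * u ^ card (insert e E - A) * f A)"
    unfolding deletion_mean_def Pow_insert
    using assms disj by (intro sum.union_disjoint) auto
  also have "(\<Sum>A\<in>Pow E. (1 - u) ^ card A * u ^ card (insert e E - A) * f A) =
      u * deletion_mean E u f"
    unfolding deletion_mean_def sum_distrib_left
  proof (rule sum.cong[OF refl])
    fix A assume "A \<in> Pow E"
    then have "insert e E - A = insert e (E - A)" "e \<notin> E - A" "finite (E - A)"
      using assms by auto
    then show "(1 - u) ^ card A * u ^ card (insert e E - A) * f A =
        u * ((1 - u) ^ card A * u ^ card (E - A) * f A)"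
      by simp
  qed
  also have "(\<Sum>A\<in>insert e ` Pow E. (1 - u) ^ card A * u ^ card (insert e E - A) * f A) =
      (1 - u) * deletion_mean E u (\<lambda>A. f (insert e A))"
    unfolding deletion_mean_def sum_distrib_left sum.reindex[OF inj] o_def
  proof (rule sum.cong[OF refl])
    fix A assume "A \<in> Pow E"
    then have "insert e E - insert e A = E - A" "e \<notin> A" "finite A"
      using assms by (auto intro: finite_subset)
    then show "(1 - u) ^ card (insert e A) * u ^ card (insert e E - insert e A) * f (insert e A) =
        (1 - u) * ((1 - u) ^ card A * u ^ card (E - A) * f (insert e A))"
      by simp
  qed
  finally show ?thesis .
qed

lemma deletion_mean_const:
  assumes "finite E"
  shows "deletion_mean E u (\<lambda>A. b) = b"
  using assms
proof (induction E rule: finite_induct)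
  case empty
  then show ?case by (simp add: deletion_mean_def)
next
  case (insert e E)
  then show ?case by (simp add: deletion_mean_insert algebra_simps)
qed

lemma deletion_mean_add:
  "deletion_mean E u (\<lambda>A. f A + g A) = deletion_mean E u f + deletion_mean E u g"
  by (simp add: deletion_mean_def sum.distrib algebra_simps)

lemma deletion_mean_diff:
  "deletion_mean E u (\<lambda>A. f A - g A) = deletion_mean E u f - deletion_mean E u g"
  by (simp add: deletion_mean_def sum_subtractf algebra_simps)

lemma deletion_mean_cmult:
  "deletion_mean E u (\<lambda>A. b * f A) = b * deletion_mean E u f"
  by (simp add: deletion_mean_def sum_distrib_left algebra_simps)

lemma deletion_mean_mono:
  assumes "0 \<le> u" "u \<le> 1" "\<And>A. A \<subseteq> E \<Longrightarrow> f A \<le> g A"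
  shows "deletion_mean E u f \<le> deletion_mean E u g"
  unfolding deletion_mean_def using assms by (intro sum_mono mult_left_mono) auto

lemma deletion_mean_one:
  assumes "finite E"
  shows "deletion_mean E 1 f = f {}"
  using assms
proof (induction E rule: finite_induct)
  case empty
  then show ?case by (simp add: deletion_mean_def)
next
  case (insert e E)
  then show ?case by (simp add: deletion_mean_insert)
qed

text \<open>Russo's formula for an integrand that itself moves with \<open>u\<close>. The influence
  of \<open>e\<close> is counted only when \<open>e\<close> is deleted, an event of probability
  \<open>u\<close>, which the division by \<open>u\<close> compensates; \<open>f' A\<close> is the
  contribution of the moving integrand.\<close>

lemma deletion_mean_Russo:
  assumes "finite E" "u \<noteq> 0"
    and "\<And>A. A \<subseteq> E \<Longrightarrow> ((\<lambda>u. f u A) has_real_derivative f' A) (at u)"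
  shows "((\<lambda>u. deletion_mean E u (f u)) has_real_derivative
    deletion_mean E u (\<lambda>A. (\<Sum>e\<in>E - A. f u A - f u (insert e A)) / u + f' A)) (at u)"
  using assms(1,3)
proof (induction E arbitrary: f f' rule: finite_induct)
  case empty
  then show ?case by (simp add: deletion_mean_def)
next
  case (insert e E)
  have 1: "((\<lambda>u. deletion_mean E u (f u)) has_real_derivative
      deletion_mean E u (\<lambda>A. (\<Sum>e\<in>E - A. f u A - f u (insert e A)) / u + f' A)) (at u)"
    by (rule insert.IH) (auto intro: insert.prems)
  have 2: "((\<lambda>u. deletion_mean E u (\<lambda>A. f u (insert e A))) has_real_derivative
      deletion_mean E u (\<lambda>A. (\<Sum>e'\<in>E - A. f u (insert e A) - f u (insert e (insert e' A))) / u
        + f' (insert e A))) (at u)"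
    by (rule insert.IH) (auto intro: insert.prems)
  have sum1: "(\<Sum>e'\<in>insert e E - A. f u A - f u (insert e' A)) =
      (f u A - f u (insert e A)) + (\<Sum>e'\<in>E - A. f u A - f u (insert e' A))" if "A \<subseteq> E" for A
  proof -
    have "insert e E - A = insert e (E - A)"
      using that insert.hyps by auto
    then show ?thesis using insert.hyps by simp
  qed
  \<comment> \<open>If \<open>e\<close> is kept, it contributes no term, and the sum is already the
    one of the induction hypothesis.\<close>
  have sum2: "(\<Sum>e'\<in>insert e E - insert e A. f u (insert e A) - f u (insert e' (insert e A))) =
      (\<Sum>e'\<in>E - A. f u (insert e A) - f u (insert e (insert e' A)))" if "A \<subseteq> E" for A
    using that insert.hyps by (intro sum.cong) (auto simp: insert_commute)
  \<comment> \<open>If \<open>e\<close> is deleted, its own term appears; times \<open>u\<close> it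
    is exactly what differentiating the weights \<open>u\<close> and \<open>1 - u\<close> of the
    recursion produces.\<close>
  have 3: "u * deletion_mean E u (\<lambda>A. (\<Sum>e'\<in>insert e E - A. f u A - f u (insert e' A)) / u + f' A) =
      deletion_mean E u (f u) - deletion_mean E u (\<lambda>A. f u (insert e A)) +
      u * deletion_mean E u (\<lambda>A. (\<Sum>e\<in>E - A. f u A - f u (insert e A)) / u + f' A)"
  proof -
    have "u * deletion_mean E u (\<lambda>A. (\<Sum>e'\<in>insert e E - A. f u A - f u (insert e' A)) / u + f' A) =
      deletion_mean E u (\<lambda>A. (f u A - f u (insert e A)) +
         u * ((\<Sum>e\<in>E - A. f u A - f u (insert e A)) / u + f' A))"
      unfolding deletion_mean_cmult[symmetric]
      unfolding deletion_mean_def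
      by (rule sum.cong[OF refl]) (use assms(2) in \<open>simp add: sum1 field_simps\<close>)
    then show ?thesis
      by (simp only: deletion_mean_add deletion_mean_diff deletion_mean_cmult)
  qed
  have 4: "deletion_mean E u (\<lambda>A. (\<Sum>e'\<in>insert e E - insert e A.
        f u (insert e A) - f u (insert e' (insert e A))) / u + f' (insert e A)) =
      deletion_mean E u (\<lambda>A. (\<Sum>e'\<in>E - A. f u (insert e A) - f u (insert e (insert e' A))) / u
        + f' (insert e A))"
    unfolding deletion_mean_def by (rule sum.cong[OF refl]) (simp only: sum2 Pow_iff)
  show ?case
    unfolding deletion_mean_insert[OF insert.hyps] 3 4
    by (auto intro!: derivative_eq_intros 1 2 simp: algebra_simps)
qed

section \<open>Components\<close>

definition connected_in :: "('v, 'e) multigraph \<Rightarrow> 'e set \<Rightarrow> ('v \<times> 'v) set" where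
  "connected_in G A = (adjacency G A)\<^sup>*"

definition component :: "('v, 'e) multigraph \<Rightarrow> 'e set \<Rightarrow> 'v \<Rightarrow> 'v set" where
  "component G A v = connected_in G A `` {v}"

text \<open>Since \<open>connected_in\<close> is symmetric and reflexive, the order in which the
  ends are named is immaterial and loops never join.\<close>

definition joining_edges :: "('v, 'e) multigraph \<Rightarrow> 'e set \<Rightarrow> 'e set" where
  "joining_edges G A = {e \<in> edges G. \<exists>u v. ends G e = {u, v} \<and> (u, v) \<notin> connected_in G A}"

lemma num_components_eq: "num_components G A = card (component G A ` verts G)"
proof -
  have "verts G // (adjacency G A)\<^sup>* = component G A ` verts G"
    by (auto simp: quotient_def component_def connected_in_def)
  then show ?thesis by (simp add: num_components_def)
qed

lemma sym_adjacency: "sym (adjacency G A)"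
  by (auto simp: sym_def adjacency_def insert_commute)

lemma connected_in_refl [simp]: "(u, u) \<in> connected_in G A"
  by (simp add: connected_in_def)

lemma connected_in_sym: "(u, v) \<in> connected_in G A \<Longrightarrow> (v, u) \<in> connected_in G A"
  unfolding connected_in_def by (rule symD[OF sym_rtrancl[OF sym_adjacency]])

lemma connected_in_trans:
  "(u, v) \<in> connected_in G A \<Longrightarrow> (v, w) \<in> connected_in G A \<Longrightarrow> (u, w) \<in> connected_in G A"
  unfolding connected_in_def by (rule rtrancl_trans)

lemma connected_in_mono: "A \<subseteq> B \<Longrightarrow> connected_in G A \<subseteq> connected_in G B"
  unfolding connected_in_def by (rule rtrancl_mono) (auto simp: adjacency_def)

lemma connected_in_verts: "(u, v) \<in> connected_in G A \<Longrightarrow> u \<in> verts G \<Longrightarrow> v \<in> verts G"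
  unfolding connected_in_def by (induction rule: rtrancl_induct) (auto simp: adjacency_def)

lemma mem_component_iff: "v \<in> component G A u \<longleftrightarrow> (u, v) \<in> connected_in G A"
  by (simp add: component_def)

lemma component_eq_iff: "component G A u = component G A v \<longleftrightarrow> (u, v) \<in> connected_in G A"
  unfolding set_eq_iff mem_component_iff
  by (meson connected_in_refl connected_in_sym connected_in_trans)

text \<open>Components of \<open>B\<close> are thus images of components of \<open>A\<close> under
  one map. Comparing component counts reduces to asking how far this map is from injective.\<close>

lemma component_coarsen:
  assumes "A \<subseteq> B"
  shows "connected_in G B `` component G A u = component G B u"
  unfolding component_def
  using connected_in_mono[OF assms] by (auto intro: connected_in_trans)

text \<open>A path that uses \<open>e\<close> links both its endpoints to ends of \<open>e\<close>.
  If neither is connected to \<open>v\<close>, both are connected to \<open>u\<close>, hence to each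
  other without \<open>e\<close>.\<close>

lemma connected_in_insert:
  assumes "ends G e = {u, v}" "(a, b) \<in> connected_in G (insert e A)"
    "(a, v) \<notin> connected_in G A" "(b, v) \<notin> connected_in G A"
  shows "(a, b) \<in> connected_in G A"
proof -
  have adj: "adjacency G (insert e A) \<subseteq> adjacency G A \<union> {(u, v), (v, u)}"
    using assms(1) by (auto simp: adjacency_def doubleton_eq_iff)
  have "(a, b) \<in> connected_in G A \<or>
      ((a, v) \<in> connected_in G A \<or> (a, u) \<in> connected_in G A) \<and>
      ((b, v) \<in> connected_in G A \<or> (b, u) \<in> connected_in G A)"
    using assms(2) unfolding connected_in_def[of G "insert e A"]
  proof (induction rule: rtrancl_induct)
    case base
    then show ?case by simp
  next
    case (step b c)
    then consider "(b, c) \<in> adjacency G A" | "b = u" "c = v" | "b = v" "c = u"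
      using adj by blast
    then show ?case
    proof cases
      case 1
      then have "(b, c) \<in> connected_in G A" by (simp add: connected_in_def r_into_rtrancl)
      with step.IH show ?thesis by (meson connected_in_sym connected_in_trans)
    qed (use step.IH in auto)
  qed
  with assms(3,4) show ?thesis by (meson connected_in_sym connected_in_trans)
qed

context
  fixes G :: "('v, 'e) multigraph"
  assumes fin: "finite_multigraph G"
begin

lemma finite_verts: "finite (verts G)" and verts_nonempty: "verts G \<noteq> {}"
  and finite_edges: "finite (edges G)"
  using fin by (auto simp: finite_multigraph_def)

lemma ends_cases:
  assumes "e \<in> edges G"
  obtains u v where "ends G e = {u, v}" "u \<in> verts G" "v \<in> verts G"
proof -
  have "card (ends G e) = 1 \<or> card (ends G e) = 2" "ends G e \<subseteq> verts G"
    using fin assms by (auto simp: finite_multigraph_def)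
  then show ?thesis
    using that by (auto simp: card_1_singleton_iff card_2_iff)
qed

lemma num_components_pos: "0 < num_components G A"
  using finite_verts verts_nonempty by (simp add: num_components_eq card_gt_0_iff)

lemma num_components_empty: "num_components G {} = card (verts G)"
proof -
  have "component G {} v = {v}" for v
    by (simp add: component_def connected_in_def adjacency_def)
  then show ?thesis by (simp add: num_components_eq card_image)
qed

section \<open>Effect of additional edges on the number of components\<close>

lemma num_components_antimono:
  assumes "A \<subseteq> B"
  shows "num_components G B \<le> num_components G A"
proof -
  have "component G B ` verts G = (\<lambda>C. connected_in G B `` C) ` component G A ` verts G"
    unfolding image_image component_coarsen[OF assms] ..
  then show ?thesis
    using finite_verts by (simp add: num_components_eq card_image_le)
qed

text \<open>The components of the two ends of \<open>e\<close> are distinct but have the same image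
  under coarsening, so one of them can be left out without losing an image.\<close>

lemma num_components_insert_joining:
  assumes "e \<in> joining_edges G A"
  shows "num_components G (insert e A) < num_components G A"
proof -
  obtain u v where e: "ends G e = {u, v}" and uv: "(u, v) \<notin> connected_in G A"
    and "e \<in> edges G"
    using assms by (auto simp: joining_edges_def)
  have V: "u \<in> verts G" "v \<in> verts G"
    using fin e \<open>e \<in> edges G\<close> by (auto simp: finite_multigraph_def)
  let ?h = "\<lambda>C. connected_in G (insert e A) `` C"
  let ?Q = "component G A ` verts G"
  have "(u, v) \<in> connected_in G (insert e A)"
    unfolding connected_in_def using V e by (intro r_into_rtrancl) (auto simp: adjacency_def)
  then have same: "?h (component G A u) = ?h (component G A v)"
    by (simp add: component_coarsen[OF subset_insertI] component_eq_iff)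
  have ne: "component G A u \<noteq> component G A v"
    using uv by (simp add: component_eq_iff)
  have "component G (insert e A) ` verts G = ?h ` ?Q"
    unfolding image_image component_coarsen[OF subset_insertI] ..
  also have "\<dots> = ?h ` (?Q - {component G A u})"
  proof -
    have "?h (component G A u) \<in> ?h ` (?Q - {component G A u})"
      unfolding same using ne V by (intro imageI) auto
    moreover have "?Q = insert (component G A u) (?Q - {component G A u})"
      using V by (simp only: insert_Diff[OF imageI])
    ultimately show ?thesis by (metis image_insert insert_absorb)
  qed
  finally have "num_components G (insert e A) \<le> card (?Q - {component G A u})"
    using finite_verts by (simp add: num_components_eq card_image_le)
  also have "\<dots> < card ?Q"
    using finite_verts V by (intro card_Diff1_less) auto
  finally show ?thesis by (simp add: num_components_eq)
qed

text \<open>Only the components of the two ends can merge, so coarsening is injective once the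
  component of \<open>v\<close> is left out.\<close>

lemma num_components_insert_ge:
  assumes "e \<in> edges G"
  shows "num_components G A \<le> num_components G (insert e A) + 1"
proof -
  obtain u v where e: "ends G e = {u, v}" and V: "u \<in> verts G" "v \<in> verts G"
    using ends_cases[OF assms] .
  let ?h = "\<lambda>C. connected_in G (insert e A) `` C"
  let ?Q = "component G A ` verts G"
  have inj: "inj_on ?h (?Q - {component G A v})"
  proof (rule inj_onI)
    fix C D assume C: "C \<in> ?Q - {component G A v}" and D: "D \<in> ?Q - {component G A v}"
      and eq: "?h C = ?h D"
    obtain a b where ab: "C = component G A a" "D = component G A b" using C D by auto
    have "(a, b) \<in> connected_in G (insert e A)"
      using eq unfolding ab component_coarsen[OF subset_insertI] component_eq_iff .
    moreover have "(a, v) \<notin> connected_in G A" "(b, v) \<notin> connected_in G A"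
      using C D unfolding ab by (auto simp: component_eq_iff)
    ultimately show "C = D"
      unfolding ab component_eq_iff using connected_in_insert[OF e] by blast
  qed
  have "card (?Q - {component G A v}) = card (?h ` (?Q - {component G A v}))"
    using card_image[OF inj] by simp
  also have "\<dots> \<le> card (?h ` ?Q)"
    using finite_verts by (intro card_mono) auto
  also have "?h ` ?Q = component G (insert e A) ` verts G"
    unfolding image_image component_coarsen[OF subset_insertI] ..
  finally show ?thesis
    using V finite_verts by (simp add: num_components_eq card_Diff_singleton_if split: if_splits)
qed

text \<open>Starting from isolated vertices, each edge lowers the count by at most one. This keeps
  the second exponent in \<open>tutte\<close> from truncating.\<close>

lemma card_verts_le:
  assumes "A \<subseteq> edges G"
  shows "card (verts G) \<le> card A + num_components G A"
proof -
  have "finite A" using assms finite_edges by (rule finite_subset)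
  then show ?thesis using assms
  proof (induction A rule: finite_induct)
    case empty
    then show ?case by (simp add: num_components_empty)
  next
    case (insert e A)
    then show ?case using num_components_insert_ge[of e A] by simp
  qed
qed

section \<open>Edges between components and the cut bound\<close>

lemma joining_edges_disjoint: "joining_edges G A \<subseteq> edges G - A"
proof
  fix e assume "e \<in> joining_edges G A"
  then obtain u v where e: "e \<in> edges G" "ends G e = {u, v}" "(u, v) \<notin> connected_in G A"
    by (auto simp: joining_edges_def)
  have "{u, v} \<subseteq> verts G"
    using fin e by (auto simp: finite_multigraph_def)
  then have "e \<notin> A"
    using e by (auto simp: connected_in_def adjacency_def)
  with e show "e \<in> edges G - A" by simp
qed

lemma crossing_component_subset:
  assumes "v \<in> verts G"
  shows "crossing_edges G (component G A v) \<subseteq> joining_edges G A"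
proof
  fix e assume e: "e \<in> crossing_edges G (component G A v)"
  then have E: "e \<in> edges G" by (simp add: crossing_edges_def)
  obtain a b where ab: "ends G e = {a, b}" using ends_cases[OF E] .
  have "(a, b) \<notin> connected_in G A"
    using e ab by (auto simp: crossing_edges_def mem_component_iff
        dest: connected_in_trans connected_in_sym)
  then show "e \<in> joining_edges G A" using E ab by (auto simp: joining_edges_def)
qed

text \<open>Double counting of pairs of a component and an edge leaving it: every component is a cut
  with at least \<open>2 * d\<close> edges, and a joining edge leaves at most two components. Having
  two components makes each of them a proper vertex subset.\<close>

lemma card_joining_edges:
  assumes conn: "enat (2 * d) \<le> edge_connectivity G" and "2 \<le> num_components G A"
  shows "num_components G A * d \<le> card (joining_edges G A)"
proof -
  let ?Q = "component G A ` verts G"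
  let ?J = "joining_edges G A"
  have finJ: "finite ?J" using joining_edges_disjoint finite_edges by (meson finite_Diff finite_subset)
  have cut: "2 * d \<le> card (crossing_edges G C)" if "C \<in> ?Q" for C
  proof -
    obtain v where v: "v \<in> verts G" "C = component G A v" using \<open>C \<in> ?Q\<close> by auto
    have sub: "C \<subseteq> verts G"
      using v by (auto simp: mem_component_iff intro: connected_in_verts)
    have "C \<noteq> verts G"
    proof
      assume "C = verts G"
      then have "component G A w = C" if "w \<in> verts G" for w
        using that v by (metis component_eq_iff mem_component_iff)
      then have "?Q \<subseteq> {C}" by auto
      then have "card ?Q \<le> 1" using card_mono[of "{C}" ?Q] by simp
      with assms(2) show False by (simp add: num_components_eq)
    qed
    moreover have "v \<in> C" using v by (simp add: mem_component_iff)
    ultimately have "edge_connectivity G \<le> enat (card (crossing_edges G C))"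
      unfolding edge_connectivity_def using sub by (intro INF_lower) auto
    with conn show ?thesis by (metis enat_ord_simps(1) order_trans)
  qed
  have two: "card {C \<in> ?Q. e \<in> crossing_edges G C} \<le> 2" if joining: "e \<in> ?J" for e
  proof -
    obtain a b where ab: "ends G e = {a, b}" using joining by (auto simp: joining_edges_def)
    have "{C \<in> ?Q. e \<in> crossing_edges G C} \<subseteq> {component G A a, component G A b}"
    proof
      fix C assume C: "C \<in> {C \<in> ?Q. e \<in> crossing_edges G C}"
      then obtain w where w: "C = component G A w" by auto
      have "a \<in> C \<or> b \<in> C" using C ab by (auto simp: crossing_edges_def)
      then have "C = component G A a \<or> C = component G A b"
        unfolding w mem_component_iff component_eq_iff .
      then show "C \<in> {component G A a, component G A b}" by simp
    qed
    then have "card {C \<in> ?Q. e \<in> crossing_edges G C} \<le> card {component G A a, component G A b}"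
      by (intro card_mono) auto
    also have "\<dots> \<le> 2" by (simp add: card_insert_if)
    finally show ?thesis .
  qed
  have "card ?Q * (2 * d) \<le> (\<Sum>C\<in>?Q. card (crossing_edges G C))"
    using sum_mono[of ?Q "\<lambda>_. 2 * d" "\<lambda>C. card (crossing_edges G C)"] cut by simp
  also have "\<dots> = (\<Sum>C\<in>?Q. \<Sum>e\<in>?J. if e \<in> crossing_edges G C then 1 else 0)"
  proof (rule sum.cong[OF refl])
    fix C assume "C \<in> ?Q"
    then have "crossing_edges G C \<subseteq> ?J" using crossing_component_subset by auto
    then have "{e \<in> ?J. e \<in> crossing_edges G C} = crossing_edges G C" by auto
    then show "card (crossing_edges G C) = (\<Sum>e\<in>?J. if e \<in> crossing_edges G C then 1 else 0)"
      using finJ by (simp add: sum.If_cases Int_def)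
  qed
  also have "\<dots> = (\<Sum>e\<in>?J. \<Sum>C\<in>?Q. if e \<in> crossing_edges G C then 1 else 0)"
    by (rule sum.swap)
  also have "\<dots> = (\<Sum>e\<in>?J. card {C \<in> ?Q. e \<in> crossing_edges G C})"
    using finite_verts by (intro sum.cong[OF refl]) (simp add: sum.If_cases Int_def)
  also have "\<dots> \<le> (\<Sum>e\<in>?J. 2)" by (rule sum_mono) (rule two)
  finally show ?thesis by (simp add: num_components_eq)
qed

section \<open>The monotone expectation\<close>

text \<open>A joining edge lowers the exponent by at least one; the remaining edges contribute
  nonnegative terms because \<open>R\<close> is at least 1.\<close>

lemma sum_component_power_diff:
  assumes "1 \<le> R" "A \<subseteq> edges G"
  shows "real (card (joining_edges G A)) * ((R - 1) * R ^ (num_components G A - 1)) \<le>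
    (\<Sum>e\<in>edges G - A. R ^ num_components G A - R ^ num_components G (insert e A))"
proof -
  have "real (card (joining_edges G A)) * ((R - 1) * R ^ (num_components G A - 1)) =
      (\<Sum>e\<in>joining_edges G A. (R - 1) * R ^ (num_components G A - 1))" by simp
  also have "\<dots> \<le> (\<Sum>e\<in>joining_edges G A. R ^ num_components G A - R ^ num_components G (insert e A))"
  proof (rule sum_mono)
    fix e assume "e \<in> joining_edges G A"
    then have "num_components G (insert e A) \<le> num_components G A - 1"
      using num_components_insert_joining by fastforce
    then have "R ^ num_components G (insert e A) \<le> R ^ (num_components G A - 1)"
      using assms(1) by (rule power_increasing)
    moreover have "R ^ num_components G A = R * R ^ (num_components G A - 1)"
      using num_components_pos[of A] by (simp add: power_eq_if)
    ultimately show "(R - 1) * R ^ (num_components G A - 1) \<le>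
        R ^ num_components G A - R ^ num_components G (insert e A)"
      by (simp add: algebra_simps)
  qed
  also have "\<dots> \<le> (\<Sum>e\<in>edges G - A. R ^ num_components G A - R ^ num_components G (insert e A))"
    using finite_edges joining_edges_disjoint assms
    by (intro sum_mono2) (auto intro!: power_increasing num_components_antimono)
  finally show ?thesis .
qed

text \<open>The curve \<open>R\<close> solves \<open>R' = - d * (R - 1) / u\<close>, so the loss
  from the decreasing base is paid for by the Russo sum. Subtracting \<open>R u\<close> makes the
  integrand vanish on connected outcomes, where the cut bound says nothing.\<close>

lemma deletion_mean_power_le:
  fixes a s :: real
  assumes conn: "enat (2 * d) \<le> edge_connectivity G"
    and a: "0 \<le> a" and s: "0 < s" "s \<le> 1"
  defines "R \<equiv> \<lambda>u. 1 + a / u ^ d"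
  shows "deletion_mean (edges G) s (\<lambda>A. R s ^ num_components G A - R s) \<le>
    (1 + a) ^ card (verts G) - 1 - a"
proof -
  define f where "f = (\<lambda>u A. R u ^ num_components G A - R u)"
  define f' where "f' = (\<lambda>u A. - (real d * (R u - 1) / u) *
    (real (num_components G A) * R u ^ (num_components G A - 1) - 1))"
  have derivR: "(R has_real_derivative - (real d * (R u - 1) / u)) (at u)" if "0 < u" for u
  proof -
    \<comment> \<open>For \<open>d = 0\<close> the exponent truncates, but both sides are 0.\<close>
    have "real d * u ^ (d - Suc 0) = real d * u ^ d / u"
      using that by (cases d) auto
    then show ?thesis
      unfolding R_def using that by (auto intro!: derivative_eq_intros simp: mult.commute)
  qed
  have derivf: "((\<lambda>u. f u A) has_real_derivative f' u A) (at u)" if "0 < u" for u A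
    unfolding f_def f'_def using derivR[OF that]
    by (auto intro!: derivative_eq_intros simp: algebra_simps)
  have nonneg: "0 \<le> deletion_mean (edges G) u
      (\<lambda>A. (\<Sum>e\<in>edges G - A. f u A - f u (insert e A)) / u + f' u A)"
    if u: "0 < u" "u \<le> 1" for u
  proof -
    have R1: "1 \<le> R u" unfolding R_def using a u by simp
    have "0 \<le> (\<Sum>e\<in>edges G - A. f u A - f u (insert e A)) / u + f' u A" if "A \<subseteq> edges G" for A
    proof -
      let ?k = "num_components G A" and ?S = "\<Sum>e\<in>edges G - A. f u A - f u (insert e A)"
      have lower: "real (card (joining_edges G A)) * ((R u - 1) * R u ^ (?k - 1)) \<le> ?S"
        unfolding f_def using sum_component_power_diff[OF R1 that] by simp
      have "real d * (R u - 1) * (real ?k * R u ^ (?k - 1) - 1) \<le> ?S"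
      \<comment> \<open>With one component the left side is 0 and the Russo sum is nonnegative.
        Otherwise at least \<open>?k * d\<close> joining edges exist, and the \<open>- 1\<close>
        only lowers the left side.\<close>
      proof (cases "?k = 1")
        case True
        have "0 \<le> real (card (joining_edges G A)) * ((R u - 1) * R u ^ (?k - 1))"
          using R1 by simp
        with lower True show ?thesis by simp
      next
        case False
        then have "2 \<le> ?k" using num_components_pos[of A] by linarith
        then have "real (?k * d) \<le> real (card (joining_edges G A))"
          using card_joining_edges[OF conn] by (simp only: of_nat_le_iff)
        then have "real (?k * d) * ((R u - 1) * R u ^ (?k - 1)) \<le> ?S"
          using lower R1 by (meson mult_right_mono order_trans mult_nonneg_nonneg
              diff_ge_0_iff_ge zero_le_power zero_le_one)
        moreover have "0 \<le> real d * (R u - 1)" using R1 by simp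
        ultimately show ?thesis by (simp add: algebra_simps)
      qed
      then have "0 \<le> (?S - real d * (R u - 1) * (real ?k * R u ^ (?k - 1) - 1)) / u"
        using u by simp
      then show ?thesis unfolding f'_def by (simp add: diff_divide_distrib)
    qed
    then have "deletion_mean (edges G) u (\<lambda>A. 0) \<le> deletion_mean (edges G) u
        (\<lambda>A. (\<Sum>e\<in>edges G - A. f u A - f u (insert e A)) / u + f' u A)"
      using u by (intro deletion_mean_mono) auto
    then show ?thesis by (simp add: deletion_mean_const finite_edges)
  qed
  have "deletion_mean (edges G) s (f s) \<le> deletion_mean (edges G) 1 (f 1)"
  proof (rule DERIV_nonneg_imp_nondecreasing[OF s(2)])
    fix u assume "s \<le> u" "u \<le> 1"
    then show "\<exists>D. ((\<lambda>u. deletion_mean (edges G) u (f u)) has_real_derivative D) (at u) \<and> 0 \<le> D"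
      using deletion_mean_Russo[OF finite_edges, of u f "f' u"] derivf nonneg s by force
  qed
  \<comment> \<open>At \<open>u = 1\<close> all edges are gone: the base is \<open>1 + a\<close> and
    every vertex is a component.\<close>
  then show ?thesis
    by (simp add: deletion_mean_one finite_edges f_def R_def num_components_empty)
qed

section \<open>From the rank expansion to the expectation\<close>

text \<open>For deletion probability \<open>1 / y\<close>, the factor \<open>y ^ m\<close> turns the
  weight of \<open>A\<close> into \<open>(y - 1) ^ card A\<close>; the powers of
  \<open>y - 1\<close> left over pair with those of \<open>x - 1\<close>.\<close>

lemma tutte_eq_deletion_mean:
  assumes "1 < y"
  shows "tutte G x y = y ^ card (edges G) / (y - 1) ^ (card (verts G) - 1) *
    deletion_mean (edges G) (1 / y) (\<lambda>A. ((x - 1) * (y - 1)) ^ (num_components G A - 1))"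
  unfolding tutte_def deletion_mean_def sum_distrib_left
proof (rule sum.cong[OF refl])
  fix A assume "A \<in> Pow (edges G)"
  then have A: "A \<subseteq> edges G" "finite A" using finite_edges finite_subset by auto
  let ?k = "num_components G A" and ?n = "card (verts G)" and ?m = "card (edges G)"
  have n: "0 < ?n" using finite_verts verts_nonempty by (simp add: card_gt_0_iff)
  have exps: "card A + ?k - ?n + (?n - 1) = card A + (?k - 1)"
    using card_verts_le[OF A(1)] num_components_pos[of A] n by linarith
  have m: "?m = card A + card (edges G - A)"
    using A finite_edges by (simp add: card_Diff_subset card_mono)
  have "y ^ ?m * ((1 - 1 / y) ^ card A * (1 / y) ^ card (edges G - A)) =
      (y * (1 - 1 / y)) ^ card A * (y * (1 / y)) ^ card (edges G - A)"
    unfolding m power_add power_mult_distrib by (simp only: mult_ac)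
  also have "y * (1 - 1 / y) = y - 1" using assms by (simp add: field_simps)
  finally have w: "y ^ ?m * ((1 - 1 / y) ^ card A * (1 / y) ^ card (edges G - A)) = (y - 1) ^ card A"
    using assms by simp
  have "(x - 1) ^ (?k - 1) * (y - 1) ^ (card A + ?k - ?n) * (y - 1) ^ (?n - 1) =
      (y - 1) ^ card A * ((x - 1) * (y - 1)) ^ (?k - 1)"
    unfolding mult.assoc power_add[symmetric] exps by (simp add: power_add power_mult_distrib)
  then show "(x - 1) ^ (?k - 1) * (y - 1) ^ (card A + ?k - ?n) =
      y ^ ?m / (y - 1) ^ (?n - 1) * ((1 - 1 / y) ^ card A * (1 / y) ^ card (edges G - A) *
        ((x - 1) * (y - 1)) ^ (?k - 1))"
    unfolding w[symmetric] using assms by (simp add: field_simps)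
qed

text \<open>The base \<open>(x - 1) * (y - 1)\<close> may be negative or small, so it is dominated
  by some \<open>R\<close> of at least 2, to which the monotone expectation applies. The last
  hypothesis keeps \<open>a\<close> below \<open>1 / n^2\<close>.\<close>

lemma tutte_approx:
  fixes x y R :: real
  assumes conn: "enat (2 * d) \<le> edge_connectivity G"
    and y: "1 < y" and R: "2 \<le> R" "\<bar>(x - 1) * (y - 1)\<bar> \<le> R"
    and d: "R * real (card (verts G)) ^ 2 \<le> y ^ d"
  shows "\<exists>\<epsilon>. \<bar>\<epsilon>\<bar> \<le> 4 / real (card (verts G)) \<and>
    tutte G x y = y ^ card (edges G) / (y - 1) ^ (card (verts G) - 1) * (1 + \<epsilon>)"
proof -
  let ?E = "edges G" and ?n = "card (verts G)" and ?Q = "(x - 1) * (y - 1)"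
  \<comment> \<open>Chosen so that the curve \<open>1 + a / u ^ d\<close> passes through
    \<open>R\<close> at \<open>u = 1 / y\<close>.\<close>
  define a where "a = (R - 1) * (1 / y) ^ d"
  define \<epsilon> where "\<epsilon> = deletion_mean ?E (1 / y) (\<lambda>A. ?Q ^ (num_components G A - 1) - 1)"
  have n: "0 < ?n" using finite_verts verts_nonempty by (simp add: card_gt_0_iff)
  have a0: "0 \<le> a" using R y by (simp add: a_def)
  have Ra: "1 + a / (1 / y) ^ d = R" using y by (simp add: a_def)
  have small: "a * real ?n ^ 2 \<le> 1"
  proof -
    have "(R - 1) * real ?n ^ 2 \<le> R * real ?n ^ 2" by (intro mult_right_mono) auto
    with d have "(R - 1) * real ?n ^ 2 \<le> y ^ d" by linarith
    then show ?thesis using y by (simp add: a_def power_one_over field_simps)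
  qed
  \<comment> \<open>Both sides vanish at \<open>k = 1\<close>. For larger \<open>k\<close>,
    \<open>R ^ k\<close> is at least \<open>2 * R ^ (k - 1)\<close>, of which one half outweighs
    \<open>R\<close>.\<close>
  have pointwise: "\<bar>?Q ^ (k - 1) - 1\<bar> \<le> 2 * (R ^ k - R)" if "0 < k" for k
  proof (cases "k = 1")
    case False
    with that have "k = Suc (Suc (k - 2))" by simp
    then obtain j where j: "k = Suc (Suc j)" ..
    have "\<bar>?Q ^ (k - 1) - 1\<bar> \<le> \<bar>?Q\<bar> ^ (k - 1) + 1"
      by (metis abs_one abs_triangle_ineq4 power_abs)
    also have "\<dots> \<le> R ^ (k - 1) + 1"
      using R by (intro add_right_mono power_mono) auto
    also have "\<dots> \<le> 2 * R ^ (k - 1)"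
      using R by (simp add: one_le_power)
    also have "\<dots> \<le> 2 * (R ^ k - R)"
    proof -
      have "R * 1 \<le> R * R ^ j" using R by (intro mult_left_mono one_le_power) auto
      moreover have "2 * R ^ Suc j \<le> R * R ^ Suc j" using R by (intro mult_right_mono) auto
      ultimately show ?thesis unfolding j by simp
    qed
    finally show ?thesis .
  qed simp
  have "\<bar>\<epsilon>\<bar> \<le> 2 * deletion_mean ?E (1 / y) (\<lambda>A. R ^ num_components G A - R)"
  proof (rule abs_leI)
    show "\<epsilon> \<le> 2 * deletion_mean ?E (1 / y) (\<lambda>A. R ^ num_components G A - R)"
      unfolding \<epsilon>_def deletion_mean_cmult[symmetric]
      using y pointwise[OF num_components_pos] by (intro deletion_mean_mono) (auto simp: abs_le_iff)
    have "- \<epsilon> = deletion_mean ?E (1 / y) (\<lambda>A. (-1) * (?Q ^ (num_components G A - 1) - 1))"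
      unfolding \<epsilon>_def deletion_mean_cmult by simp
    also have "\<dots> \<le> deletion_mean ?E (1 / y) (\<lambda>A. 2 * (R ^ num_components G A - R))"
      using y pointwise[OF num_components_pos] by (intro deletion_mean_mono) (auto simp: abs_le_iff)
    finally show "- \<epsilon> \<le> 2 * deletion_mean ?E (1 / y) (\<lambda>A. R ^ num_components G A - R)"
      unfolding deletion_mean_cmult .
  qed
  also have "\<dots> \<le> 2 * ((1 + a) ^ ?n - 1 - a)"
    using deletion_mean_power_le[OF conn a0, of "1 / y"] y unfolding Ra by simp
  also have "\<dots> \<le> 2 * (2 * (real ?n * a))"
  proof -
    have na: "real ?n * (real ?n * a) \<le> 1"
      using small by (simp add: power2_eq_square mult_ac)
    have "1 * (real ?n * a) \<le> real ?n * (real ?n * a)"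
      using n a0 by (intro mult_right_mono) auto
    with na have "real ?n * a \<le> 1" by linarith
    \<comment> \<open>As \<open>n * a\<close> lies in the unit interval, the quadratic bound on
      \<open>exp\<close> applies and its square term is at most \<open>n * a\<close>.\<close>
    have "(1 + a) ^ ?n \<le> exp a ^ ?n"
      using a0 by (intro power_mono) auto
    also have "\<dots> = exp (real ?n * a)" by (simp add: exp_of_nat_mult)
    also have "\<dots> \<le> 1 + real ?n * a + (real ?n * a)\<^sup>2"
      using \<open>real ?n * a \<le> 1\<close> a0 by (intro exp_bound) auto
    also have "(real ?n * a)\<^sup>2 \<le> real ?n * a"
      using \<open>real ?n * a \<le> 1\<close> a0 by (simp add: power2_eq_square mult_left_le)
    finally have "(1 + a) ^ ?n \<le> 1 + real ?n * a + real ?n * a" by simp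
    moreover have "2 * (z - 1 - a) \<le> 2 * (2 * t)" if "z \<le> 1 + t + t" for z t
      using that a0 by simp
    ultimately show ?thesis by blast
  qed
  also have "\<dots> \<le> 4 / real ?n"
    using small n by (simp add: field_simps power2_eq_square)
  finally have bound: "\<bar>\<epsilon>\<bar> \<le> 4 / real ?n" .
  have "1 + \<epsilon> = deletion_mean ?E (1 / y) (\<lambda>A. ?Q ^ (num_components G A - 1))"
    unfolding \<epsilon>_def by (simp add: deletion_mean_diff deletion_mean_const finite_edges)
  with bound show ?thesis using tutte_eq_deletion_mean[OF y] by metis
qed

end

section \<open>Choice of the connectivity threshold\<close>

text \<open>For \<open>y > 1\<close>, \<open>x > 0\<close> and \<open>n > 0\<close> this is the
  least \<open>d\<close> with \<open>R * n^2 \<le> y ^ d\<close>, where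
  \<open>R = 2 + (x + 1) * y\<close> exceeds both 2 and the modulus of
  \<open>(x - 1) * (y - 1)\<close>. It is half the threshold because cuts of \<open>2 * d\<close>
  edges are required.\<close>

definition half_threshold :: "real \<Rightarrow> real \<Rightarrow> nat \<Rightarrow> nat" where
  "half_threshold y x n = nat \<lceil>(2 * ln (real n) + ln (2 + (x + 1) * y)) / ln y\<rceil>"

lemma power_half_threshold_ge:
  assumes "1 < y" "0 < x" "0 < n"
  shows "(2 + (x + 1) * y) * real n ^ 2 \<le> y ^ half_threshold y x n"
proof -
  let ?R = "2 + (x + 1) * y"
  have R: "0 < ?R" using assms by (simp add: add_pos_pos)
  have "(2 * ln (real n) + ln ?R) / ln y \<le> real (half_threshold y x n)"
    unfolding half_threshold_def by linarith
  then have "2 * ln (real n) + ln ?R \<le> real (half_threshold y x n) * ln y"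
    using assms by (simp add: field_simps)
  moreover have "ln (?R * real n ^ 2) = 2 * ln (real n) + ln ?R"
    using R assms by (simp add: ln_mult ln_realpow)
  moreover have "ln (y ^ half_threshold y x n) = real (half_threshold y x n) * ln y"
    using assms by (simp add: ln_realpow)
  ultimately show ?thesis
    using R assms by (metis ln_le_cancel_iff less_trans zero_less_one zero_less_power mult_pos_pos
        of_nat_0_less_iff)
qed

lemma half_threshold_le:
  assumes "1 < y" "0 < x" "0 < n"
  shows "real (half_threshold y x n) \<le> (2 * ln (real n) + ln (2 + (x + 1) * y)) / ln y + 1"
proof -
  \<comment> \<open>A nonnegative quotient ensures that \<open>nat\<close> does not raise the
    ceiling.\<close>
  have "0 \<le> ln (2 + (x + 1) * y)" using assms by (intro ln_ge_zero) (simp add: add_increasing2)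
  then have "0 \<le> (2 * ln (real n) + ln (2 + (x + 1) * y)) / ln y"
    using assms by simp
  then show ?thesis unfolding half_threshold_def by linarith
qed

text \<open>The lower bound on \<open>ln n\<close> absorbs the possibly negative
  \<open>2 * ln x\<close> and the constant \<open>ln (3 / x0 + 1)\<close>; its final 1 keeps the
  logarithm of the product at least 1, which pays for rounding up.\<close>

lemma half_threshold_le_ln:
  assumes y: "1 < y0" "y0 \<le> y" and x: "0 < x0" "x0 \<le> x" and "0 < n"
    and n: "2 * \<bar>ln x0\<bar> + ln (3 / x0 + 1) + 1 \<le> ln (real n)"
  shows "real (half_threshold y x n) \<le> (3 / ln y0 + 1) * ln (real n * x * y)"
    and "1 \<le> ln (real n * x * y)"
proof -
  let ?R = "2 + (x + 1) * y" and ?l = "ln (real n * x * y)"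
  have l: "?l = ln (real n) + ln x + ln y"
    using assms by (simp add: ln_mult)
  have lx: "ln x0 \<le> ln x" and ly: "ln y0 \<le> ln y" "0 < ln y0"
    using assms by auto
  have L: "0 \<le> ln (3 / x0 + 1)" using x by (intro ln_ge_zero) simp
  show one: "1 \<le> ?l" using l lx ly L n by linarith
  \<comment> \<open>Here \<open>2 + y\<close> is at most \<open>3 * y\<close>, and
    \<open>x / x0\<close> is at least 1.\<close>
  have "?R \<le> x * y * (3 / x0 + 1)"
  proof -
    have "3 * y \<le> x * y * (3 / x0)"
      using x y by (simp add: field_simps)
    then show ?thesis using y by (simp add: algebra_simps)
  qed
  then have "ln ?R \<le> ln (x * y * (3 / x0 + 1))"
    using x y by (intro ln_mono) (auto simp: add_pos_pos)
  also have "\<dots> = ln x + ln y + ln (3 / x0 + 1)"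
    using x y by (subst ln_mult_pos, auto simp: ln_mult_pos intro!: mult_pos_pos add_pos_pos)
  finally have "2 * ln (real n) + ln ?R \<le> 3 * ?l"
    using l lx ly L n by linarith
  then have "(2 * ln (real n) + ln ?R) / ln y \<le> 3 * ?l / ln y0"
    using ly one by (intro frac_le) auto
  then show "real (half_threshold y x n) \<le> (3 / ln y0 + 1) * ?l"
    using half_threshold_le[of y x n] assms one by (simp add: algebra_simps)
qed

lemma eventually_ln_ge: "\<forall>\<^sub>F n in sequentially. 0 < n \<and> b \<le> ln (real n)"
proof -
  have "filterlim (\<lambda>n. ln (real n)) at_top sequentially"
    by (rule filterlim_compose[OF ln_at_top filterlim_real_sequentially])
  then have "\<forall>\<^sub>F n in sequentially. b \<le> ln (real n)"
    by (simp add: filterlim_at_top)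
  with eventually_gt_at_top[of 0] show ?thesis by eventually_elim simp
qed

text \<open>The bound on \<open>c\<close> is uniform for \<open>x \<ge> x0\<close> and
  \<open>y \<ge> y0\<close> as \<open>n\<close> grows: near \<open>y = 1\<close> the factor
  \<open>1 / ln y\<close> blows up, and for tiny \<open>x\<close> the logarithm of
  \<open>n * x * y\<close> may vanish or be negative. \<open>C\<close> is fixed before
  \<open>x\<close>, \<open>y\<close> and the graph.\<close>

theorem theorem6p1:
  "\<exists>(c :: real \<Rightarrow> real \<Rightarrow> nat \<Rightarrow> nat) (C :: real).
     (\<forall>y0 > 1. \<forall>x0 > 0.
        (\<lambda>(n, x, y). real (c y x n))
          \<in> O[sequentially \<times>\<^sub>F (principal {x0..} \<times>\<^sub>F principal {y0..})](\<lambda>(n, x, y).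
              y * ln (real n * x * y))) \<and>
     (\<forall>y > 1. \<forall>x > 0. (\<lambda>n. real (c y x n)) \<in> O(\<lambda>n. ln (real n))) \<and>
     (\<forall>y > 1. \<forall>x > 0. \<forall>(G :: ('v, 'e) multigraph) n m.
        finite_multigraph G \<longrightarrow> card (verts G) = n \<longrightarrow> card (edges G) = m \<longrightarrow>
        edge_connectivity G > enat (c y x n) \<longrightarrow>
        (\<exists>\<epsilon>. \<bar>\<epsilon>\<bar> \<le> C / real n \<and>
             tutte G x y = y ^ m / (y - 1) ^ (n - 1) * (1 + \<epsilon>)))"
proof (rule exI[of _ "\<lambda>y x n. 2 * half_threshold y x n"], rule exI[of _ 4], intro conjI allI impI)
  fix y0 x0 :: real assume y0: "1 < y0" and x0: "0 < x0"
  let ?P = "\<lambda>n. 0 < n \<and> 2 * \<bar>ln x0\<bar> + ln (3 / x0 + 1) + 1 \<le> ln (real n)"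
  \<comment> \<open>Only \<open>n\<close> has to become large; the principal filters supply the
    bounds on \<open>x\<close> and \<open>y\<close>.\<close>
  have ev: "\<forall>\<^sub>F (n, x, y) in sequentially \<times>\<^sub>F (principal {x0..} \<times>\<^sub>F principal {y0..}).
      ?P n \<and> x0 \<le> x \<and> y0 \<le> y"
    unfolding principal_prod_principal eventually_prod_filter
    by (rule exI[of _ ?P], rule exI[of _ "\<lambda>(x, y). x0 \<le> x \<and> y0 \<le> y"])
      (auto simp: eventually_principal intro: eventually_ln_ge)
  show "(\<lambda>(n, x, y). real (2 * half_threshold y x n))
      \<in> O[sequentially \<times>\<^sub>F (principal {x0..} \<times>\<^sub>F principal {y0..})](\<lambda>(n, x, y).
          y * ln (real n * x * y))"
  proof (rule bigoI[where c = "2 * (3 / ln y0 + 1)"], rule eventually_mono[OF ev], clarify)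
    fix n :: nat and x y :: real
    assume H: "0 < n" "2 * \<bar>ln x0\<bar> + ln (3 / x0 + 1) + 1 \<le> ln (real n)" "x0 \<le> x" "y0 \<le> y"
    let ?l = "ln (real n * x * y)"
    have b: "real (half_threshold y x n) \<le> (3 / ln y0 + 1) * ?l" and one: "1 \<le> ?l"
      using half_threshold_le_ln[OF y0 H(4) x0 H(3) H(1) H(2)] .
    have "1 * ?l \<le> y * ?l" using one y0 H by (intro mult_right_mono) auto
    then have "(3 / ln y0 + 1) * ?l \<le> (3 / ln y0 + 1) * (y * ?l)"
      using y0 by (intro mult_left_mono) auto
    with b have "real (2 * half_threshold y x n) \<le> 2 * (3 / ln y0 + 1) * (y * ?l)" by linarith
    moreover have "0 \<le> y * ?l" using one y0 H by simp
    ultimately show "norm (real (2 * half_threshold y x n)) \<le> 2 * (3 / ln y0 + 1) * norm (y * ?l)"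
      by simp
  qed
next
  fix y x :: real assume y: "1 < y" and x: "0 < x"
  let ?K = "ln (2 + (x + 1) * y)"
  show "(\<lambda>n. real (2 * half_threshold y x n)) \<in> O(\<lambda>n. ln (real n))"
  proof (rule bigoI[where c = "2 * (3 / ln y + 1)"],
      rule eventually_mono[OF eventually_ln_ge[of "\<bar>?K\<bar> + 1"]], clarify)
    fix n :: nat assume H: "0 < n" "\<bar>?K\<bar> + 1 \<le> ln (real n)"
    \<comment> \<open>With \<open>x\<close> and \<open>y\<close> fixed, \<open>?K\<close> is a
      constant that \<open>ln n\<close> eventually dominates, together with the 1 from
      rounding.\<close>
    have "(2 * ln (real n) + ?K) / ln y \<le> 3 * ln (real n) / ln y"
      using H y by (intro divide_right_mono) auto
    then have "real (half_threshold y x n) \<le> (3 / ln y + 1) * ln (real n)"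
      using half_threshold_le[OF y x H(1)] H by (simp add: algebra_simps)
    then have "real (2 * half_threshold y x n) \<le> 2 * (3 / ln y + 1) * ln (real n)" by linarith
    moreover have "0 \<le> ln (real n)" using H by linarith
    ultimately show "norm (real (2 * half_threshold y x n)) \<le> 2 * (3 / ln y + 1) * norm (ln (real n))"
      by simp
  qed
next
  fix y x :: real and G :: "('v, 'e) multigraph" and n m :: nat
  assume y: "1 < y" and x: "0 < x" and G: "finite_multigraph G"
    and n: "card (verts G) = n" and m: "card (edges G) = m"
    and conn: "enat (2 * half_threshold y x n) < edge_connectivity G"
  have n0: "0 < n" using G n by (auto simp: finite_multigraph_def card_gt_0_iff)
  have pos: "0 < (x + 1) * y" using x y by simp
  have "\<bar>x - 1\<bar> * \<bar>y - 1\<bar> \<le> (x + 1) * y"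
    using x y by (intro mult_mono) auto
  with pos have R: "2 \<le> 2 + (x + 1) * y" "\<bar>(x - 1) * (y - 1)\<bar> \<le> 2 + (x + 1) * y"
    by (auto simp: abs_mult)
  show "\<exists>\<epsilon>. \<bar>\<epsilon>\<bar> \<le> 4 / real n \<and> tutte G x y = y ^ m / (y - 1) ^ (n - 1) * (1 + \<epsilon>)"
    using tutte_approx[OF G less_imp_le[OF conn] y R] power_half_threshold_ge[OF y x n0] n m by simp
qed

end
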